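(* Let $n=2$. For every $a\in(0,1)$, $L(a)\ge 1+a$.
   Context: $\mathbb{B}^n=\{x\in\mathbb{R}^n:|x|<1\}$. For a domain $G\subsetneq\mathbb{R}^n$ and $x,y\in G$, the triangular ratio metric is $$s_G(x,y)=\sup_{z\in\partial G}\frac{|x-y|}{|x-z|+|z-y|}.$$ For $a\in(0,1)$ let $C(a)$ be the class of all Möbius transformations $h:\mathbb{B}^n\to\mathbb{B}^n$ (with $h(\mathbb{B}^n)=\mathbb{B}^n$) such that $|h(0)|=a$, and define $$L(a)=\sup\left\{\frac{s_{\mathbb{B}^n}(h(x),h(y))}{s_{\mathbb{B}^n}(x,y)}:\ x,y\in\mathbb{B}^n,\ x\ne y,\ h\in C(a)\right\}.$$ *)

theory Defs
  imports "HOL-Analysis.Analysis" "HOL-Library.Extended_Real"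
begin

definition triangular_ratio :: "'a::euclidean_space set \<Rightarrow> 'a \<Rightarrow> 'a \<Rightarrow> real" where
  "triangular_ratio G x y = (SUP z\<in>frontier G. norm (x - y) / (norm (x - z) + norm (z - y)))"

text \<open>The one-point compactification of a Euclidean space is represented by the option type,
  with \<open>None\<close> as the point at infinity.\<close>

definition sphere_reflection :: "'a::euclidean_space \<Rightarrow> real \<Rightarrow> 'a option \<Rightarrow> 'a option" where
  "sphere_reflection c r p = (case p of
      None \<Rightarrow> Some c
    | Some x \<Rightarrow> if x = c then None
               else Some (c + (r\<^sup>2 / (norm (x - c))\<^sup>2) *\<^sub>R (x - c)))"

text \<open>Reflection in the hyperplane of all \<open>x\<close> with \<open>x \<bullet> u = t\<close>; \<open>u\<close> need not be a unit vector.\<close>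

definition plane_reflection :: "'a::euclidean_space \<Rightarrow> real \<Rightarrow> 'a option \<Rightarrow> 'a option" where
  "plane_reflection u t p =
     map_option (\<lambda>x. x - (2 * (x \<bullet> u - t) / (norm u)\<^sup>2) *\<^sub>R u) p"

text \<open>Moebius transformations are the finite compositions of reflections; both
  orientation-preserving and orientation-reversing maps are included.\<close>

inductive moebius :: "('a::euclidean_space option \<Rightarrow> 'a option) \<Rightarrow> bool" where
  moebius_id: "moebius id"
| moebius_sphere: "moebius g \<Longrightarrow> r > 0 \<Longrightarrow> moebius (sphere_reflection c r \<circ> g)"
| moebius_plane: "moebius g \<Longrightarrow> u \<noteq> 0 \<Longrightarrow> moebius (plane_reflection u t \<circ> g)"

text \<open>A member of the class below is constrained only on the unit ball, where it is the
  restriction of a Moebius transformation; its values off the ball are irrelevant.\<close>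

definition moebius_ball_class :: "real \<Rightarrow> ('a::euclidean_space \<Rightarrow> 'a) set" where
  "moebius_ball_class a = {h.
     (\<exists>g. moebius g \<and> (\<forall>x\<in>ball 0 1. g (Some x) = Some (h x))) \<and>
     h ` ball 0 1 = ball 0 1 \<and> norm (h 0) = a}"

text \<open>The supremum is taken in the extended reals, so that it is meaningful without
  knowing that the quotients are bounded. The type argument selects the Euclidean space.\<close>

definition lipschitz_sup :: "'a::euclidean_space itself \<Rightarrow> real \<Rightarrow> ereal" where
  "lipschitz_sup _ a = Sup {ereal (triangular_ratio (ball 0 1) (h x) (h y) /
                                   triangular_ratio (ball 0 1) x y) | (h :: 'a \<Rightarrow> 'a) x y.
     x \<in> ball 0 1 \<and> y \<in> ball 0 1 \<and> x \<noteq> y \<and> h \<in> moebius_ball_class a}"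

end

theory Submission
  imports Defs
begin

text \<open>
  For nearby points \<open>x\<close> and \<open>y\<close>, the triangular ratio metric of the unit ball behaves like
  \<open>norm (x - y) / (2 * (1 - norm x))\<close>, while a Moebius self-map \<open>h\<close> of the ball scales lengths at
  \<open>x\<close> by \<open>(1 - (norm (h x))\<^sup>2) / (1 - (norm x)\<^sup>2)\<close>. Infinitesimally, \<open>h\<close> therefore
  expands the metric at \<open>x\<close> by the factor \<open>(1 + norm (h x)) / (1 + norm x)\<close>. At \<open>x = 0\<close> this
  factor is \<open>1 + a\<close>, so the quotients of points tending to \<open>0\<close> already give the bound.

  To make this exact, the argument stays on one radius, spanned by a unit vector \<open>e\<close>. There the
  supremum in the metric is attained at the end point \<open>e\<close> of the radius
  (\<open>triangular_ratio_radial\<close>). For \<open>h\<close> one can take a single reflection, in the sphere with centre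
  \<open>e /\<^sub>R a\<close> orthogonal to the unit sphere (\<open>ball_inversion_in_moebius_ball_class\<close>). It maps the
  radius by \<open>t \<mapsto> (a - t) / (1 - a * t)\<close>, so the pair \<open>0\<close>, \<open>t e\<close> moves to \<open>a e\<close> and a point
  closer to the origin, and its quotient is \<open>(1 + a) * (2 - t) / (2 + t * (1 - a))\<close>, which tends
  to \<open>1 + a\<close> as \<open>t\<close> decreases to \<open>0\<close>.
\<close>

section \<open>The triangular ratio metric along a radius\<close>

text \<open>By the triangle inequality the end point \<open>e\<close> of the radius is, among all points of the
  sphere, simultaneously nearest to both points, hence it minimises the sum of the two distances.\<close>

lemma triangular_ratio_radial:
  fixes e :: "'a::euclidean_space"
  assumes e: "norm e = 1" and p: "0 \<le> p" "p < 1" and q: "0 \<le> q" "q < 1"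
  shows "triangular_ratio (ball 0 1) (p *\<^sub>R e) (q *\<^sub>R e) = \<bar>p - q\<bar> / (2 - p - q)"
proof -
  have diff: "norm (s *\<^sub>R e - t *\<^sub>R e) = \<bar>s - t\<bar>" for s t
    by (simp add: e flip: scaleR_left_diff_distrib)
  have dist_sphere: "1 - s \<le> norm (s *\<^sub>R e - z)" if "0 \<le> s" "norm z = 1" for s z
    using norm_triangle_ineq2[of z "s *\<^sub>R e"] that e by (simp add: norm_minus_commute)
  have "norm (p *\<^sub>R e - e) = 1 - p" "norm (e - q *\<^sub>R e) = 1 - q"
    using diff[of p 1] diff[of 1 q] p q by auto
  then have attained: "\<bar>p - q\<bar> / (2 - p - q)
      = norm (p *\<^sub>R e - q *\<^sub>R e) / (norm (p *\<^sub>R e - e) + norm (e - q *\<^sub>R e))"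
    by (simp add: diff algebra_simps)
  have bound: "norm (p *\<^sub>R e - q *\<^sub>R e) / (norm (p *\<^sub>R e - z) + norm (z - q *\<^sub>R e))
      \<le> \<bar>p - q\<bar> / (2 - p - q)" if "norm z = 1" for z
    unfolding diff
    using dist_sphere[of p z] dist_sphere[of q z] that p q
    by (intro divide_left_mono mult_pos_pos) (auto simp: norm_minus_commute)
  show ?thesis
    unfolding triangular_ratio_def
  proof (rule cSup_eq_maximum)
    show "\<bar>p - q\<bar> / (2 - p - q) \<in>
        (\<lambda>z. norm (p *\<^sub>R e - q *\<^sub>R e) / (norm (p *\<^sub>R e - z) + norm (z - q *\<^sub>R e)))
          ` frontier (ball 0 1)"
      by (rule image_eqI[where x = e]) (use e attained in simp_all)
  qed (use bound in auto)
qed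

section \<open>Reflections that preserve the unit ball\<close>

text \<open>The reflection in the sphere with centre \<open>c\<close> that is orthogonal to the unit sphere: by
  Pythagoras its squared radius is \<open>(norm c)\<^sup>2 - 1\<close>.\<close>

definition ball_inversion :: "'a::euclidean_space \<Rightarrow> 'a \<Rightarrow> 'a" where
  "ball_inversion c x = c + (((norm c)\<^sup>2 - 1) / (norm (x - c))\<^sup>2) *\<^sub>R (x - c)"

text \<open>Orthogonality is what makes the signs of \<open>1 - (norm x)\<^sup>2\<close> before and after the reflection
  agree.\<close>

lemma one_minus_norm_ball_inversion:
  assumes "x \<noteq> c"
  shows "1 - (norm (ball_inversion c x))\<^sup>2
    = ((norm c)\<^sup>2 - 1) / (norm (x - c))\<^sup>2 * (1 - (norm x)\<^sup>2)"
proof -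
  define D where "D = (norm (x - c))\<^sup>2"
  define k where "k = ((norm c)\<^sup>2 - 1) / D"
  have kD: "k * D = (norm c)\<^sup>2 - 1"
    using assms by (simp add: k_def D_def)
  have polar: "2 * (c \<bullet> (x - c)) = (norm x)\<^sup>2 - D - (norm c)\<^sup>2"
    unfolding D_def power2_norm_eq_inner
    by (simp add: inner_diff_left inner_diff_right inner_commute)
  have "(norm (ball_inversion c x))\<^sup>2 = (norm c)\<^sup>2 + k * (2 * (c \<bullet> (x - c))) + k * (k * D)"
    unfolding ball_inversion_def k_def[symmetric] D_def[symmetric]
    unfolding power2_norm_eq_inner D_def
    by (simp add: inner_add_left inner_add_right inner_commute algebra_simps)
  also have "\<dots> = (norm c)\<^sup>2 - k * D + k * ((norm x)\<^sup>2 - 1)"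
    unfolding polar kD using kD by (simp add: algebra_simps)
  also have "\<dots> = 1 - k * (1 - (norm x)\<^sup>2)"
    unfolding kD by (simp add: algebra_simps)
  finally show ?thesis
    by (simp add: k_def D_def)
qed

lemma ball_inversion_in_ball:
  assumes c: "1 < norm c" and x: "x \<in> ball 0 1"
  shows "ball_inversion c x \<in> ball 0 1"
proof -
  have "x \<noteq> c" using c x by auto
  moreover have "(norm x)\<^sup>2 < 1" "1 < (norm c)\<^sup>2"
    using c x by (auto simp: power_less_one_iff one_less_power)
  ultimately have "0 < 1 - (norm (ball_inversion c x))\<^sup>2"
    by (simp add: one_minus_norm_ball_inversion)
  then show ?thesis
    by (simp add: power_less_one_iff)
qed

lemma ball_inversion_involution:
  assumes c: "1 < norm c" and x: "x \<noteq> c"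
  shows "ball_inversion c (ball_inversion c x) = x"
proof -
  define k where "k = ((norm c)\<^sup>2 - 1) / (norm (x - c))\<^sup>2"
  have inv: "ball_inversion c x - c = k *\<^sub>R (x - c)"
    by (simp add: ball_inversion_def k_def)
  have "1 < (norm c)\<^sup>2" using c by (simp add: one_less_power)
  then have k: "k \<noteq> 0" "(norm c)\<^sup>2 - 1 = k * (norm (x - c))\<^sup>2"
    using x by (simp_all add: k_def)
  have "ball_inversion c (ball_inversion c x)
      = c + (k * (norm (x - c))\<^sup>2 / (norm (k *\<^sub>R (x - c)))\<^sup>2 * k) *\<^sub>R (x - c)"
    unfolding ball_inversion_def[of c "ball_inversion c x"] inv k(2) by simp
  also have "k * (norm (x - c))\<^sup>2 / (norm (k *\<^sub>R (x - c)))\<^sup>2 * k = 1"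
    using k(1) x by (simp add: power_mult_distrib power2_eq_square[of k])
  finally show ?thesis by simp
qed

lemma moebius_ball_inversion:
  assumes "1 < norm c"
  shows "\<exists>g. moebius g \<and> (\<forall>x\<in>ball 0 1. g (Some x) = Some (ball_inversion c x))"
proof -
  define r where "r = sqrt ((norm c)\<^sup>2 - 1)"
  have "1 < (norm c)\<^sup>2" using assms by (simp add: one_less_power)
  then have r: "0 < r" "r\<^sup>2 = (norm c)\<^sup>2 - 1" by (simp_all add: r_def)
  have "moebius (sphere_reflection c r \<circ> id)"
    using r by (intro moebius_sphere moebius_id)
  moreover have "(sphere_reflection c r \<circ> id) (Some x) = Some (ball_inversion c x)"
    if "x \<in> ball 0 1" for x
    using that assms by (auto simp: sphere_reflection_def ball_inversion_def r)
  ultimately show ?thesis by blast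
qed

lemma ball_inversion_radial:
  fixes e :: "'a::euclidean_space"
  assumes e: "norm e = 1" and a: "0 < a" "a < 1" and t: "t < 1"
  shows "ball_inversion (e /\<^sub>R a) (t *\<^sub>R e) = ((a - t) / (1 - a * t)) *\<^sub>R e"
proof -
  have at: "a * t < 1" using a t
    by (smt (verit) mult_less_cancel_left2)
  have sub: "t *\<^sub>R e - e /\<^sub>R a = (t - 1 / a) *\<^sub>R e"
    by (simp add: scaleR_left_diff_distrib divide_inverse)
  have ne: "t - 1 / a \<noteq> 0" using a at by (auto simp: field_simps)
  have "ball_inversion (e /\<^sub>R a) (t *\<^sub>R e)
      = (1 / a + (1 / a\<^sup>2 - 1) / (t - 1 / a)\<^sup>2 * (t - 1 / a)) *\<^sub>R e"
    unfolding ball_inversion_def sub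
    by (simp add: e scaleR_left_distrib power_divide divide_inverse power_inverse)
  also have "1 / a + (1 / a\<^sup>2 - 1) / (t - 1 / a)\<^sup>2 * (t - 1 / a)
      = 1 / a + (1 / a\<^sup>2 - 1) / (t - 1 / a)"
    using ne by (simp add: power2_eq_square)
  also have "t - 1 / a = (a * t - 1) / a"
    using a by (simp add: field_simps)
  also have "1 / a + (1 / a\<^sup>2 - 1) / ((a * t - 1) / a) = (a - t) / (1 - a * t)"
    using a at by (simp add: divide_simps power2_eq_square) (simp add: algebra_simps)
  finally show ?thesis .
qed

lemma ball_inversion_in_moebius_ball_class:
  fixes e :: "'a::euclidean_space"
  assumes e: "norm e = 1" and a: "0 < a" "a < 1"
  shows "ball_inversion (e /\<^sub>R a) \<in> moebius_ball_class a"
proof -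
  have c: "1 < norm (e /\<^sub>R a)"
    using e a by (simp add: one_less_inverse)
  have "ball_inversion (e /\<^sub>R a) ` ball 0 1 = ball 0 1"
  proof
    show "ball_inversion (e /\<^sub>R a) ` ball 0 1 \<subseteq> ball 0 1"
      using ball_inversion_in_ball[OF c] by blast
    show "ball 0 1 \<subseteq> ball_inversion (e /\<^sub>R a) ` ball 0 1"
    proof
      fix y :: 'a assume y: "y \<in> ball 0 1"
      then have "y \<noteq> e /\<^sub>R a" using c by auto
      then have "y = ball_inversion (e /\<^sub>R a) (ball_inversion (e /\<^sub>R a) y)"
        by (rule ball_inversion_involution[OF c, symmetric])
      then show "y \<in> ball_inversion (e /\<^sub>R a) ` ball 0 1"
        using ball_inversion_in_ball[OF c y] by (rule image_eqI)
    qed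
  qed
  moreover have "norm (ball_inversion (e /\<^sub>R a) 0) = a"
    using ball_inversion_radial[OF e a, of 0] e a by simp
  ultimately show ?thesis
    using moebius_ball_inversion[OF c] by (simp add: moebius_ball_class_def)
qed

section \<open>The lower bound\<close>

text \<open>The quotient is that of the pair \<open>0\<close>, \<open>t e\<close> under the reflection centred at \<open>e /\<^sub>R a\<close>.
  The bound \<open>t < a\<close> keeps the image of \<open>t e\<close> on the same radius, where the metric is explicit.\<close>

lemma radial_quotient_le_lipschitz_sup:
  assumes a: "0 < a" "a < 1" and t: "0 < t" "t < a"
  shows "ereal ((1 + a) * (2 - t) / (2 + t * (1 - a))) \<le> lipschitz_sup TYPE('a::euclidean_space) a"
proof -
  obtain e :: 'a where e: "norm e = 1"
    using vector_choose_size[of 1] by auto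
  define h where "h = ball_inversion (e /\<^sub>R a)"
  define b where "b = (a - t) / (1 - a * t)"
  have at: "a * t < 1" using a t
    by (smt (verit) mult_less_cancel_left2)
  have "a - t < 1 - a * t"
    using mult_pos_pos[of "1 - a" "1 + t"] a t by (simp add: algebra_simps)
  then have b: "0 \<le> b" "b < 1"
    using at t by (simp_all add: b_def)
  have a_minus_b: "a - b = t * (1 - a) * (1 + a) / (1 - a * t)"
    using at by (simp add: b_def divide_simps) (simp add: algebra_simps)
  have sum: "2 - a - b = (1 - a) * (2 + t * (1 - a)) / (1 - a * t)"
    using at by (simp add: b_def divide_simps) (simp add: algebra_simps)
  have pos: "0 < 2 + t * (1 - a)"
    using a t by (simp add: add_pos_pos)
  have h0: "h 0 = a *\<^sub>R e" and ht: "h (t *\<^sub>R e) = b *\<^sub>R e"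
    using ball_inversion_radial[OF e a, of 0] ball_inversion_radial[OF e a, of t] a t
    by (simp_all add: h_def b_def)
  have before: "triangular_ratio (ball 0 1) 0 (t *\<^sub>R e) = t / (2 - t)"
    using triangular_ratio_radial[OF e, of 0 t] a t by simp
  have "0 \<le> a - b"
    unfolding a_minus_b using a t at by simp
  then have "triangular_ratio (ball 0 1) (h 0) (h (t *\<^sub>R e)) = (a - b) / (2 - a - b)"
    using triangular_ratio_radial[OF e, of a b] a b by (simp add: h0 ht)
  also have "\<dots> = t * (1 + a) / (2 + t * (1 - a))"
    unfolding a_minus_b sum using a at pos by simp
  finally have quotient: "(1 + a) * (2 - t) / (2 + t * (1 - a)) =
      triangular_ratio (ball 0 1) (h 0) (h (t *\<^sub>R e)) / triangular_ratio (ball 0 1) 0 (t *\<^sub>R e)"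
    unfolding before using a t by simp
  have "h \<in> moebius_ball_class a"
    using ball_inversion_in_moebius_ball_class[OF e a] by (simp add: h_def)
  moreover have "0 \<noteq> t *\<^sub>R e" "t *\<^sub>R e \<in> ball 0 1"
    using e a t by auto
  ultimately show ?thesis
    unfolding lipschitz_sup_def quotient
    by (intro Sup_upper CollectI exI[of _ h] exI[of _ 0] exI[of _ "t *\<^sub>R e"]) auto
qed

theorem theorem1p5:
  fixes a :: real
  assumes "0 < a" and "a < 1"
  shows "lipschitz_sup TYPE(real ^ 2) a \<ge> ereal (1 + a)"
proof (rule tendsto_upperbound)
  have "((\<lambda>t. (1 + a) * (2 - t) / (2 + t * (1 - a))) \<longlongrightarrow>
      (1 + a) * (2 - 0) / (2 + 0 * (1 - a))) (at_right 0)"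
    by (intro tendsto_intros) auto
  then show "((\<lambda>t. ereal ((1 + a) * (2 - t) / (2 + t * (1 - a)))) \<longlongrightarrow> ereal (1 + a)) (at_right 0)"
    by (simp add: add_divide_distrib)
  show "\<forall>\<^sub>F t in at_right 0.
      ereal ((1 + a) * (2 - t) / (2 + t * (1 - a))) \<le> lipschitz_sup TYPE(real ^ 2) a"
    using assms by (auto simp: eventually_at_right_field intro!: exI[of _ a]
        radial_quotient_le_lipschitz_sup)
qed simp

end
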